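(* Let $u$ be the entropy solution of the Cauchy problem $u_t+f(u)_x=0$, $u|_{t=0}=\varphi\in L^\infty(\mathbb{R})$. (i) If $\overline u_l<\underline u_r$, then $u$ has divides. For any $x_0\in\mathbb{R}$, $\mathcal{D}(x_0)\ne\varnothing$ if and only if $\Phi(x_0)=\bar\Phi(x_0)$, and in this case $\mathcal{D}(x_0)=[\mathrm D_-\bar\Phi(x_0),\mathrm D_+\bar\Phi(x_0)]$. Furthermore, for such $x_0$: (a) If $\mathrm D_-\bar\Phi(x_0)=\mathrm D_+\bar\Phi(x_0)$, there is a unique divide emitting from $x_0$, given by $x=x_0+tf'(\mathrm D_-\bar\Phi(x_0))$, $t\in\mathbb{R}^+$. (b) If $\mathrm D_-\bar\Phi(x_0)<\mathrm D_+\bar\Phi(x_0)$, the divides emitting from $x_0$ form a rarefaction wave: $u(x,t)=(f')^{-1}\big(\frac{x-x_0}{t}\big)$ for $x\in\big(x_0+tf'(\mathrm D_-\bar\Phi(x_0)),\,x_0+tf'(\mathrm D_+\bar\Phi(x_0))\big)$. (ii) If $\overline u_l=\underline u_r$, then $u$ has divides if and only if there exists $x_0\in\mathbb{R}$ such that $\Phi(x_0)=\bar\Phi(x_0)$; in this case the unique divide emitting from $x_0$ is $x=x_0+tf'(\underline u_r)$, $t\in\mathbb{R}^+$. (iii) If $\overline u_l>\underline u_r$, then $u$ has no divides.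
   Context: Setting: $f\in C^2(\mathbb{R})$, $f''\ge0$, $\mathcal{L}\{f''=0\}=0$ (Lebesgue measure), so $f'$ is strictly increasing; $\varphi\in L^\infty(\mathbb R)$; $\mathbb R^+=(0,\infty)$. For $t>0$: $E(u;x,t)=t\int_0^u f''(s)(\varphi(x-tf'(s))-s)\,ds$; $\mathcal{U}(x,t)$ is the (nonempty compact) set of maximizers of $E(\cdot\,;x,t)$; the entropy solution is $u(x,t)=\inf\mathcal{U}(x,t)$. $L_c(x_0)=\{(x,t):x=x_0+tf'(c),\ t>0\}$; $\mathcal{D}(x_0)=\{c\in\mathbb{R}:\mathcal{U}(x,t)=\{c\}\text{ for all }(x,t)\in L_c(x_0)\}$; for $c\in\mathcal{D}(x_0)$, $L_c(x_0)$ is called a divide emitting from $x_0$; $u$ "has divides" if $\mathcal D(x_0)\ne\varnothing$ for some $x_0$. $\Phi(x)=\int_0^x\varphi\,d\xi$; $\overline u_l=\limsup_{x\to-\infty}\Phi(x)/x$, $\underline u_r=\liminf_{x\to\infty}\Phi(x)/x$. Convex hull over $(-\infty,\infty)$: $\bar\Phi(x)=\lim_{N\to\infty}\bar\Phi_N(x)\in[-\infty,\infty)$, where $\bar\Phi_N$ is the convex hull (largest convex minorant) of $\Phi|_{[-N,N]}$ on $[-N,N]$ and equals $\Phi$ for $|x|\ge N$. When $\bar\Phi$ is finite it is convex, and $\mathrm D_\pm\bar\Phi$ are its right/left derivatives. *)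

theory Defs
  imports "HOL-Analysis.Analysis"
begin

definition C2 :: "(real \<Rightarrow> real) \<Rightarrow> bool" where
  "C2 f \<longleftrightarrow> f differentiable_on UNIV \<and> deriv f differentiable_on UNIV
     \<and> continuous_on UNIV (deriv (deriv f))"

text \<open>The space of essentially bounded functions is rendered by representatives.  All integrals
  below are taken with respect to \<^const>\<open>lebesgue\<close> (not \<^const>\<open>lborel\<close>), so that an
  arbitrary Lebesgue measurable representative is admitted, and they are oriented: they change sign
  when the upper limit is below the lower one.\<close>

definition L_infinity :: "(real \<Rightarrow> real) set" where
  "L_infinity = {\<phi> \<in> borel_measurable lebesgue. \<exists>M. AE x in lebesgue. \<bar>\<phi> x\<bar> \<le> M}"

definition E_fun :: "(real \<Rightarrow> real) \<Rightarrow> (real \<Rightarrow> real) \<Rightarrow> real \<Rightarrow> real \<Rightarrow> real \<Rightarrow> real" where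
  "E_fun f \<phi> x t u =
     t * (LINT s=ereal 0..ereal u|lebesgue. (deriv (deriv f) s * (\<phi> (x - t * deriv f s) - s)))"

definition maximizers :: "(real \<Rightarrow> real) \<Rightarrow> (real \<Rightarrow> real) \<Rightarrow> real \<Rightarrow> real \<Rightarrow> real set" where
  "maximizers f \<phi> x t = {u. \<forall>v. E_fun f \<phi> x t v \<le> E_fun f \<phi> x t u}"

text \<open>The entropy solution of \<open>u\<^sub>t + f(u)\<^sub>x = 0\<close> with initial datum \<open>\<phi>\<close>, given by its variational
  formula; it is meaningful for \<open>t > 0\<close>, where the set of maximizers is nonempty and compact.\<close>

definition entropy_solution :: "(real \<Rightarrow> real) \<Rightarrow> (real \<Rightarrow> real) \<Rightarrow> real \<Rightarrow> real \<Rightarrow> real" where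
  "entropy_solution f \<phi> x t = Inf (maximizers f \<phi> x t)"

definition char_line :: "(real \<Rightarrow> real) \<Rightarrow> real \<Rightarrow> real \<Rightarrow> (real \<times> real) set" where
  "char_line f x\<^sub>0 c = {(x, t). x = x\<^sub>0 + t * deriv f c \<and> t > 0}"

definition divide_states :: "(real \<Rightarrow> real) \<Rightarrow> (real \<Rightarrow> real) \<Rightarrow> real \<Rightarrow> real set" where
  "divide_states f \<phi> x\<^sub>0 = {c. \<forall>(x, t) \<in> char_line f x\<^sub>0 c. maximizers f \<phi> x t = {c}}"

definition divides_from :: "(real \<Rightarrow> real) \<Rightarrow> (real \<Rightarrow> real) \<Rightarrow> real \<Rightarrow> (real \<times> real) set set" where
  "divides_from f \<phi> x\<^sub>0 = char_line f x\<^sub>0 ` divide_states f \<phi> x\<^sub>0"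

definition has_divides :: "(real \<Rightarrow> real) \<Rightarrow> (real \<Rightarrow> real) \<Rightarrow> bool" where
  "has_divides f \<phi> \<longleftrightarrow> (\<exists>x\<^sub>0. divide_states f \<phi> x\<^sub>0 \<noteq> {})"

definition primitive :: "(real \<Rightarrow> real) \<Rightarrow> real \<Rightarrow> real" where
  "primitive \<phi> x = (LINT \<xi>=ereal 0..ereal x|lebesgue. \<phi> \<xi>)"

text \<open>For \<open>\<phi>\<close> in \<^const>\<open>L_infinity\<close> the two mean values below are finite;
  they live in \<^typ>\<open>ereal\<close> only because \<^const>\<open>Limsup\<close> and \<^const>\<open>Liminf\<close> need a complete lattice.\<close>

definition upper_mean_left :: "(real \<Rightarrow> real) \<Rightarrow> ereal" where
  "upper_mean_left \<phi> = Limsup at_bot (\<lambda>x. ereal (primitive \<phi> x / x))"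

definition lower_mean_right :: "(real \<Rightarrow> real) \<Rightarrow> ereal" where
  "lower_mean_right \<phi> = Liminf at_top (\<lambda>x. ereal (primitive \<phi> x / x))"

text \<open>The largest convex minorant of \<open>F\<close> on a bounded interval is the pointwise supremum of all
  convex minorants; for continuous \<open>F\<close> the supremum is over a nonempty set bounded by \<open>F x\<close>.\<close>

definition convex_hull_on :: "real \<Rightarrow> (real \<Rightarrow> real) \<Rightarrow> real \<Rightarrow> real" where
  "convex_hull_on N F x =
     (if \<bar>x\<bar> \<ge> N then F x
      else (SUP g \<in> {g. convex_on {-N..N} g \<and> (\<forall>y \<in> {-N..N}. g y \<le> F y)}. g x))"

text \<open>The limit is monotone decreasing in \<open>N\<close>, hence exists in \<^typ>\<open>ereal\<close>; it may be \<open>-\<infinity>\<close>.\<close>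

definition convex_hull_fun :: "(real \<Rightarrow> real) \<Rightarrow> real \<Rightarrow> ereal" where
  "convex_hull_fun F x = Lim at_top (\<lambda>N. ereal (convex_hull_on N F x))"

definition right_deriv :: "(real \<Rightarrow> real) \<Rightarrow> real \<Rightarrow> real" where
  "right_deriv g x = Lim (at_right x) (\<lambda>y. (g y - g x) / (y - x))"

definition left_deriv :: "(real \<Rightarrow> real) \<Rightarrow> real \<Rightarrow> real" where
  "left_deriv g x = Lim (at_left x) (\<lambda>y. (g y - g x) / (y - x))"

text \<open>One-sided derivatives of the convex hull of the primitive.  They are meaningful when the hull
  is finite; a hull that is finite at one point is finite, and convex, on the whole line.\<close>

definition hull_right_deriv :: "(real \<Rightarrow> real) \<Rightarrow> real \<Rightarrow> real" where
  "hull_right_deriv \<phi> = right_deriv (\<lambda>x. real_of_ereal (convex_hull_fun (primitive \<phi>) x))"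

definition hull_left_deriv :: "(real \<Rightarrow> real) \<Rightarrow> real \<Rightarrow> real" where
  "hull_left_deriv \<phi> = left_deriv (\<lambda>x. real_of_ereal (convex_hull_fun (primitive \<phi>) x))"

end

theory Submission
  imports Defs
begin

text \<open>Substituting \<open>\<xi> = x - t f'(s)\<close> turns the maximizers of \<open>E\<close> into the minimizers of
  \<open>u \<mapsto> \<Phi>(x - t f'(u)) + t (u f'(u) - f(u))\<close>.  By strict convexity of \<open>f\<close>, the state \<open>c\<close> is the unique
  minimizer all along the line \<open>x = x\<^sub>0 + t f'(c)\<close> if and only if the line of slope \<open>c\<close> through
  \<open>(x\<^sub>0, \<Phi>(x\<^sub>0))\<close> supports \<open>\<Phi>\<close> globally: one direction is a tangent line estimate for \<open>f\<close>, the other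
  is obtained by letting the competitor \<open>u\<close> tend to \<open>c\<close> while \<open>t\<close> keeps \<open>x - t f'(u)\<close> fixed.  So
  \<open>\<D>(x\<^sub>0)\<close> is the subdifferential of \<open>\<Phi>\<close> at \<open>x\<^sub>0\<close>.  Where \<open>\<Phi>\<close> touches its convex hull this is also
  the subdifferential of the hull, elsewhere it is empty, and the slope \<open>c\<close> of a supporting line
  satisfies \<open>u\<^sub>l \<le> c \<le> u\<^sub>r\<close> for the two mean values at infinity.\<close>

subsection \<open>Subdifferentials and one-sided derivatives\<close>

text \<open>The supporting inequality is global and \<open>F\<close> is not assumed convex, so the
  notion applies to the primitive of the datum as well as to its hull.\<close>

definition subdifferential :: "(real \<Rightarrow> real) \<Rightarrow> real \<Rightarrow> real set" where
  "subdifferential F x = {c. \<forall>y. F x + c * (y - x) \<le> F y}"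

text \<open>The three-chord inequality, arranged so that \<open>y\<close> and \<open>z\<close> may
  lie on either side of the base point \<open>x\<close>. The cases are the possible positions of
  \<open>x\<close>, and \<open>swap\<close> uses that a difference quotient is symmetric in its two
  points.\<close>

lemma convex_on_quotient_mono:
  fixes g :: "real \<Rightarrow> real"
  assumes "convex_on UNIV g" "y \<noteq> x" "z \<noteq> x" "y \<le> z"
  shows "(g y - g x) / (y - x) \<le> (g z - g x) / (z - x)"
proof -
  have swap: "(g v - g w) / (v - w) = (g w - g v) / (w - v)" for v w
    by (metis minus_diff_eq minus_divide_divide)
  consider "y = z" | "x < y" "y < z" | "y < x" "x < z" | "y < z" "z < x"
    using assms by linarith
  then show ?thesis
  proof cases
    case 2
    then show ?thesis
      using convex_on_slope_le(1)[OF assms(1), of x z y] swap by simp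
  next
    case 3
    then show ?thesis
      using convex_on_slope_le[OF assms(1), of y z x] swap[of z x] by simp
  next
    case 4
    then show ?thesis
      using convex_on_slope_le(2)[OF assms(1), of y x z] by simp
  qed simp
qed

text \<open>The quotient decreases as \<open>y\<close> decreases to \<open>x\<close> and is bounded
  below by its value at \<open>x - 1\<close>, so the limit exists and is the infimum. This shows
  that the \<open>Lim\<close> in the definition is a genuine limit.\<close>

lemma right_deriv_convex:
  assumes "convex_on UNIV g"
  shows "right_deriv g x = (INF y\<in>{x<..}. (g y - g x) / (y - x))"
proof -
  let ?s = "\<lambda>y. (g y - g x) / (y - x)"
  have bdd: "bdd_below (?s ` {x<..})"
    by (rule bdd_belowI2[of _ "?s (x - 1)"])
      (use convex_on_quotient_mono[OF assms, of "x - 1" x] in auto)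
  have "(?s \<longlongrightarrow> (INF y\<in>{x<..}. ?s y)) (at_right x)"
  proof (rule order_tendstoI)
    fix a assume "a < (INF y\<in>{x<..}. ?s y)"
    then have "a < ?s y" if "y > x" for y
      using cINF_lower[OF bdd, of y] that by auto
    then show "\<forall>\<^sub>F y in at_right x. a < ?s y"
      by (auto simp: eventually_at_right_less intro: eventually_mono[OF eventually_at_right_less])
  next
    fix a assume "(INF y\<in>{x<..}. ?s y) < a"
    then obtain b where b: "x < b" "?s b < a"
      using bdd by (auto simp: cINF_less_iff)
    have "?s y < a" if "x < y" "y < b" for y
      using convex_on_quotient_mono[OF assms, of y x b] that b by force
    then show "\<forall>\<^sub>F y in at_right x. ?s y < a"
      using b(1) by (auto simp: eventually_at_right)
  qed
  then show ?thesis
    unfolding right_deriv_def by (intro tendsto_Lim) auto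
qed

lemma left_deriv_convex:
  assumes "convex_on UNIV g"
  shows "left_deriv g x = (SUP y\<in>{..<x}. (g y - g x) / (y - x))"
proof -
  let ?s = "\<lambda>y. (g y - g x) / (y - x)"
  have bdd: "bdd_above (?s ` {..<x})"
    by (rule bdd_aboveI2[of _ _ "?s (x + 1)"])
      (use convex_on_quotient_mono[OF assms, of _ x "x + 1"] in auto)
  have "(?s \<longlongrightarrow> (SUP y\<in>{..<x}. ?s y)) (at_left x)"
  proof (rule order_tendstoI)
    fix a assume "(SUP y\<in>{..<x}. ?s y) < a"
    then have "?s y < a" if "y < x" for y
      using cSUP_upper[OF _ bdd, of y] that by auto
    moreover have "\<forall>\<^sub>F y in at_left x. y < x"
      by (auto simp: eventually_at_filter)
    ultimately show "\<forall>\<^sub>F y in at_left x. ?s y < a"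
      by (auto elim: eventually_mono)
  next
    fix a assume "a < (SUP y\<in>{..<x}. ?s y)"
    then obtain b where b: "b < x" "a < ?s b"
      using bdd by (auto simp: less_cSUP_iff)
    have "a < ?s y" if "b < y" "y < x" for y
      using convex_on_quotient_mono[OF assms, of b x y] that b by force
    then show "\<forall>\<^sub>F y in at_left x. a < ?s y"
      using b(1) by (auto simp: eventually_at_left)
  qed
  then show ?thesis
    unfolding left_deriv_def by (intro tendsto_Lim) auto
qed

text \<open>Dividing the supporting inequality by \<open>y - x\<close> reverses it to the left of
  \<open>x\<close>: subgradients are the numbers separating left slopes from right slopes.\<close>

lemma subdifferential_quotient_iff:
  "c \<in> subdifferential F x \<longleftrightarrow>
     (\<forall>y<x. (F y - F x) / (y - x) \<le> c) \<and> (\<forall>y>x. c \<le> (F y - F x) / (y - x))"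
proof -
  have "F x + c * (y - x) \<le> F y \<longleftrightarrow> (F y - F x) / (y - x) \<le> c" if "y < x" for y
    using that by (simp add: neg_divide_le_eq algebra_simps)
  moreover have "F x + c * (y - x) \<le> F y \<longleftrightarrow> c \<le> (F y - F x) / (y - x)" if "y > x" for y
    using that by (simp add: pos_le_divide_eq algebra_simps)
  ultimately show ?thesis
    unfolding subdifferential_def mem_Collect_eq
    by (metis diff_self linorder_neqE_linordered_idom mult_zero_right add_0_right order_refl)
qed

lemma subdifferential_convex:
  assumes "convex_on UNIV g"
  shows "subdifferential g x = {left_deriv g x..right_deriv g x}"
proof -
  let ?s = "\<lambda>y. (g y - g x) / (y - x)"
  have "bdd_above (?s ` {..<x})"
    by (rule bdd_aboveI2[of _ _ "?s (x + 1)"])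
      (use convex_on_quotient_mono[OF assms, of _ x "x + 1"] in auto)
  then have "left_deriv g x \<le> c \<longleftrightarrow> (\<forall>y<x. ?s y \<le> c)" for c
    unfolding left_deriv_convex[OF assms] by (subst cSUP_le_iff) auto
  moreover have "bdd_below (?s ` {x<..})"
    by (rule bdd_belowI2[of _ "?s (x - 1)"])
      (use convex_on_quotient_mono[OF assms, of "x - 1" x] in auto)
  then have "c \<le> right_deriv g x \<longleftrightarrow> (\<forall>y>x. c \<le> ?s y)" for c
    unfolding right_deriv_convex[OF assms] by (subst le_cINF_iff) auto
  ultimately show ?thesis
    by (auto simp: subdifferential_quotient_iff)
qed

subsection \<open>Convex hulls\<close>

text \<open>Names the index set of the supremum in \<open>convex_hull_on\<close>. For negative
  \<open>N\<close> the interval is empty and every function belongs to it.\<close>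

definition convex_minorants :: "real \<Rightarrow> (real \<Rightarrow> real) \<Rightarrow> (real \<Rightarrow> real) set" where
  "convex_minorants N F = {g. convex_on {-N..N} g \<and> (\<forall>y\<in>{-N..N}. g y \<le> F y)}"

lemma convex_hull_on_inside:
  "\<bar>x\<bar> < N \<Longrightarrow> convex_hull_on N F x = (SUP g\<in>convex_minorants N F. g x)"
  by (simp add: convex_hull_on_def convex_minorants_def)

lemma convex_minorants_le:
  assumes "g \<in> convex_minorants N F" "\<bar>x\<bar> \<le> N"
  shows "g x \<le> F x"
proof -
  have "x \<in> {-N..N}" using assms(2) by auto
  then show ?thesis using assms(1) by (auto simp: convex_minorants_def)
qed

lemma convex_minorants_nonempty:
  assumes "continuous_on UNIV F"
  shows "convex_minorants N F \<noteq> {}"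
proof -
  obtain m where "\<forall>y\<in>{-N..N}. m \<le> F y"
  proof (cases "{-N..N} = {}")
    case False
    then obtain x where "\<forall>y\<in>{-N..N}. F x \<le> F y"
      using continuous_attains_inf[of "{-N..N}" F] continuous_on_subset[OF assms] by auto
    then show ?thesis using that by blast
  qed (use that in blast)
  then have "(\<lambda>_. m) \<in> convex_minorants N F"
    by (simp add: convex_minorants_def convex_on_const)
  then show ?thesis by blast
qed

lemma convex_minorant_le_hull:
  assumes "g \<in> convex_minorants N F" "\<bar>x\<bar> \<le> N"
  shows "g x \<le> convex_hull_on N F x"
proof (cases "\<bar>x\<bar> = N")
  case True
  \<comment> \<open>At an endpoint the hull equals \<open>F\<close> by definition, so the bound by
    \<open>F\<close> is enough; only inside is the supremum involved.\<close>
  then show ?thesis using convex_minorants_le[OF assms] by (simp add: convex_hull_on_def)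
next
  case False
  with assms have x: "\<bar>x\<bar> < N" by simp
  have "bdd_above ((\<lambda>g. g x) ` convex_minorants N F)"
    using x by (intro bdd_aboveI2[of _ _ "F x"]) (auto intro: convex_minorants_le)
  then show ?thesis
    unfolding convex_hull_on_inside[OF x] by (intro cSUP_upper assms)
qed

lemma convex_hull_on_least:
  assumes "continuous_on UNIV F" "\<bar>x\<bar> < N" "\<And>g. g \<in> convex_minorants N F \<Longrightarrow> g x \<le> m"
  shows "convex_hull_on N F x \<le> m"
  unfolding convex_hull_on_inside[OF assms(2)]
  using convex_minorants_nonempty[OF assms(1)] assms(3) by (intro cSUP_least) auto

lemma convex_hull_on_le:
  assumes "continuous_on UNIV F"
  shows "convex_hull_on N F x \<le> F x"
proof (cases "\<bar>x\<bar> < N")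
  case True
  then show ?thesis
    by (intro convex_hull_on_least assms) (auto intro: convex_minorants_le)
qed (simp add: convex_hull_on_def)

text \<open>A convex minorant on the larger interval restricts to one on the smaller interval, so
  enlarging \<open>N\<close> shrinks the competition. If \<open>x\<close> is not inside the smaller
  interval, the hull there is \<open>F x\<close> and the general bound by \<open>F\<close>
  applies.\<close>

lemma convex_hull_on_antimono:
  assumes "continuous_on UNIV F" "N \<le> N'"
  shows "convex_hull_on N' F x \<le> convex_hull_on N F x"
proof (cases "\<bar>x\<bar> < N")
  case True
  have "g x \<le> convex_hull_on N F x" if "g \<in> convex_minorants N' F" for g
  proof (rule convex_minorant_le_hull)
    show "g \<in> convex_minorants N F"
      using that assms(2) unfolding convex_minorants_def
      by (auto intro: convex_on_subset[of "{-N'..N'}"])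
  qed (use True in simp)
  then show ?thesis
    using True assms by (intro convex_hull_on_least) auto
next
  case False
  then show ?thesis
    using convex_hull_on_le[OF assms(1), of N'] by (simp add: convex_hull_on_def)
qed

lemma tendsto_at_top_antimono_ereal:
  fixes h :: "real \<Rightarrow> ereal"
  assumes "\<And>M N. M \<le> N \<Longrightarrow> h N \<le> h M"
  shows "(h \<longlongrightarrow> (INF N. h N)) at_top"
proof (rule order_tendstoI)
  fix a assume "a < (INF N. h N)"
  then have "a < h N" for N
    by (meson INF_lower UNIV_I less_le_trans)
  then show "\<forall>\<^sub>F N in at_top. a < h N" by simp
next
  fix a assume "(INF N. h N) < a"
  then obtain M where "h M < a" by (auto simp: INF_less_iff)
  then have "\<forall>N\<ge>M. h N < a" using assms le_less_trans by blast
  then show "\<forall>\<^sub>F N in at_top. h N < a" by (auto simp: eventually_at_top_linorder)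
qed

section \<open>The limit of the hulls over growing intervals\<close>

context
  fixes F :: "real \<Rightarrow> real"
  assumes F: "continuous_on UNIV F"
begin

lemma convex_hull_on_tendsto:
  "((\<lambda>N. ereal (convex_hull_on N F x)) \<longlongrightarrow> (INF N. ereal (convex_hull_on N F x))) at_top"
  by (rule tendsto_at_top_antimono_ereal) (simp add: convex_hull_on_antimono[OF F])

lemma convex_hull_fun_INF: "convex_hull_fun F x = (INF N. ereal (convex_hull_on N F x))"
  unfolding convex_hull_fun_def by (intro tendsto_Lim convex_hull_on_tendsto) simp

lemma convex_hull_fun_le: "convex_hull_fun F x \<le> ereal (F x)"
  unfolding convex_hull_fun_INF
  \<comment> \<open>For the index \<open>\<bar>x\<bar>\<close> the point is an endpoint, where the
    hull is \<open>F x\<close>.\<close>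
  by (rule INF_lower2[of "\<bar>x\<bar>"]) (simp_all add: convex_hull_on_def)

text \<open>A global affine minorant competes in every \<open>convex_minorants N F\<close>. The
  resulting bound is uniform in \<open>N\<close>, which keeps the limit of the hulls finite.\<close>

lemma affine_minorant_le_hull:
  assumes "\<And>y. a + c * y \<le> F y"
  shows "a + c * x \<le> convex_hull_on N F x"
proof (cases "\<bar>x\<bar> \<le> N")
  case True
  have "convex_on {-N..N} (\<lambda>y. a + c * y)"
    by (intro convex_onI) (simp_all add: algebra_simps)
  with assms have "(\<lambda>y. a + c * y) \<in> convex_minorants N F"
    by (simp add: convex_minorants_def)
  from convex_minorant_le_hull[OF this True] show ?thesis .
next
  case False
  then show ?thesis using assms by (simp add: convex_hull_on_def)
qed

lemma affine_minorant_le_hull_fun: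
  assumes "\<And>y. a + c * y \<le> F y"
  shows "ereal (a + c * x) \<le> convex_hull_fun F x"
  unfolding convex_hull_fun_INF by (rule INF_greatest) (simp add: affine_minorant_le_hull assms)

lemma convex_hull_fun_real:
  assumes "\<And>y. a + c * y \<le> F y"
  shows "ereal (real_of_ereal (convex_hull_fun F x)) = convex_hull_fun F x"
  using affine_minorant_le_hull_fun[OF assms, of x] convex_hull_fun_le[of x]
  by (cases "convex_hull_fun F x") auto

text \<open>The convexity inequality at two given points holds once \<open>N\<close> exceeds both
  absolute values, and then passes to the limit. For fixed \<open>N\<close> it is available only
  inside the interval, since outside \<open>convex_hull_on N F\<close> is \<open>F\<close>
  itself.\<close>

lemma convex_on_convex_hull_fun:
  assumes "\<And>y. a + c * y \<le> F y"
  shows "convex_on UNIV (\<lambda>x. real_of_ereal (convex_hull_fun F x))" (is "convex_on _ ?H")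
proof (rule convex_onI)
  fix t x y :: real assume t: "0 < t" "t < 1"
  let ?z = "(1 - t) *\<^sub>R x + t *\<^sub>R y"
  have lim: "((\<lambda>N. convex_hull_on N F w) \<longlongrightarrow> ?H w) at_top" for w
    using convex_hull_on_tendsto[of w] convex_hull_fun_real[OF assms, of w]
    by (metis convex_hull_fun_INF lim_ereal)
  have le: "convex_hull_on N F ?z \<le> (1 - t) * convex_hull_on N F x + t * convex_hull_on N F y"
    if N: "\<bar>x\<bar> < N" "\<bar>y\<bar> < N" for N
  proof (rule convex_hull_on_least[OF F])
    have "?z \<in> {-N<..<N}"
      using N t by (intro convexD_alt) auto
    then show "\<bar>?z\<bar> < N" by auto
    fix g assume g: "g \<in> convex_minorants N F"
    then have "g ?z \<le> (1 - t) * g x + t * g y"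
      using N t by (intro convex_onD[of "{-N..N}"]) (auto simp: convex_minorants_def)
    also have "\<dots> \<le> (1 - t) * convex_hull_on N F x + t * convex_hull_on N F y"
      using convex_minorant_le_hull[OF g] N t by (intro add_mono mult_left_mono) auto
    finally show "g ?z \<le> (1 - t) * convex_hull_on N F x + t * convex_hull_on N F y" .
  qed
  have "\<forall>\<^sub>F N in at_top. convex_hull_on N F ?z \<le> (1 - t) * convex_hull_on N F x + t * convex_hull_on N F y"
    using eventually_gt_at_top[of "\<bar>x\<bar>"] eventually_gt_at_top[of "\<bar>y\<bar>"]
    by eventually_elim (rule le)
  then show "?H ?z \<le> (1 - t) * ?H x + t * ?H y"
    by (rule tendsto_le[rotated 3]) (auto intro!: tendsto_intros lim)
qed simp

lemma subdifferential_affine_minorant: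
  assumes "c \<in> subdifferential F x"
  shows "(F x - c * x) + c * y \<le> F y"
  using assms by (auto simp: subdifferential_def algebra_simps)

lemma hull_eq_of_subdifferential:
  assumes "c \<in> subdifferential F x"
  shows "ereal (F x) = convex_hull_fun F x"
  using affine_minorant_le_hull_fun[OF subdifferential_affine_minorant[OF assms], of x]
    convex_hull_fun_le[of x] by simp

text \<open>The hulls decrease in \<open>N\<close>, so contact in the limit means \<open>F x\<close>
  is at most every \<open>convex_hull_on N F x\<close>. Convex minorants lie below all chords of
  \<open>F\<close>, hence so does \<open>F x\<close>. Thus left slopes at \<open>x\<close> never
  exceed right slopes, and the supremum of the left slopes is a subgradient.\<close>

lemma subdifferential_nonempty_of_hull_eq:
  assumes "ereal (F x) = convex_hull_fun F x"
  shows "subdifferential F x \<noteq> {}"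
proof -
  let ?s = "\<lambda>y. (F y - F x) / (y - x)"
  have slopes: "?s y \<le> ?s z" if "y < x" "x < z" for y z
  proof -
    \<comment> \<open>All three points lie strictly inside the interval of radius \<open>N\<close>,
      and \<open>t\<close> is the barycentric coordinate of \<open>x\<close> between
      \<open>y\<close> and \<open>z\<close>.\<close>
    define N where "N = \<bar>x\<bar> + \<bar>y\<bar> + \<bar>z\<bar> + 1"
    define t where "t = (x - y) / (z - y)"
    have t: "0 \<le> t" "t \<le> 1" and x: "x = (1 - t) *\<^sub>R y + t *\<^sub>R z"
    proof -
      show "0 \<le> t" "t \<le> 1"
        using that by (auto simp: t_def)
      have "t * (z - y) = x - y"
        using that by (simp add: t_def)
      then show "x = (1 - t) *\<^sub>R y + t *\<^sub>R z"
        by (simp add: algebra_simps)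
    qed
    have "convex_hull_fun F x \<le> ereal (convex_hull_on N F x)"
      unfolding convex_hull_fun_INF by (rule INF_lower) simp
    then have "F x \<le> convex_hull_on N F x"
      unfolding assms[symmetric] by simp
    also have "\<dots> \<le> (1 - t) * F y + t * F z"
    proof (rule convex_hull_on_least[OF F])
      fix g assume g: "g \<in> convex_minorants N F"
      have "g x \<le> (1 - t) * g y + t * g z"
        using g t unfolding convex_minorants_def
        by (subst x, intro convex_onD[of "{-N..N}"]) (auto simp: N_def)
      also have "\<dots> \<le> (1 - t) * F y + t * F z"
        using t by (intro add_mono mult_left_mono convex_minorants_le[OF g]) (auto simp: N_def)
      finally show "g x \<le> (1 - t) * F y + t * F z" .
    qed (simp add: N_def)
    \<comment> \<open>Multiplying by \<open>z - y\<close> clears the denominator of \<open>t\<close>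
      and leaves the chord inequality in the form that rearranges to slopes.\<close>
    finally have "(z - y) * F x \<le> (z - y) * ((1 - t) * F y + t * F z)"
      using that by (intro mult_left_mono) auto
    also have "\<dots> = (z - x) * F y + (x - y) * F z"
    proof -
      have "(z - y) * ((1 - t) * F y + t * F z) = (z - y - t * (z - y)) * F y + t * (z - y) * F z"
        by (simp add: algebra_simps)
      also have "t * (z - y) = x - y"
        using that by (simp add: t_def)
      finally show ?thesis by simp
    qed
    finally show ?thesis
      using that by (simp add: divide_simps) (simp add: algebra_simps)
  qed
  let ?c = "SUP y\<in>{..<x}. ?s y"
  have "?s y \<le> ?c" if "y < x" for y
    using that slopes[of _ "x + 1"]
    by (intro cSUP_upper bdd_aboveI2[of _ _ "?s (x + 1)"]) auto
  moreover have "?c \<le> ?s z" if "z > x" for z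
    using that slopes by (intro cSUP_least) auto
  ultimately show ?thesis
    using subdifferential_quotient_iff[of ?c F x] by blast
qed

text \<open>At a contact point \<open>F\<close> and its hull \<open>H\<close> have the same
  supporting lines: a line below \<open>F\<close> is below \<open>H\<close>, and \<open>H\<close> is
  below \<open>F\<close>. The convex case then applies to \<open>H\<close>, whose finiteness comes
  from any one supporting line of \<open>F\<close>.\<close>

lemma subdifferential_eq_hull_derivs:
  assumes "ereal (F x) = convex_hull_fun F x"
  defines "H \<equiv> \<lambda>y. real_of_ereal (convex_hull_fun F y)"
  shows "subdifferential F x = {left_deriv H x..right_deriv H x}"
proof -
  obtain c where "c \<in> subdifferential F x"
    using subdifferential_nonempty_of_hull_eq[OF assms(1)] by blast
  note c = subdifferential_affine_minorant[OF this]
  have H: "ereal (H y) = convex_hull_fun F y" for y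
    unfolding H_def using convex_hull_fun_real[OF c] .
  have Hx: "H x = F x"
    using H[of x] unfolding assms(1)[symmetric] by simp
  have "subdifferential F x = subdifferential H x"
  proof (intro subset_antisym subsetI)
    fix d assume "d \<in> subdifferential F x"
    from affine_minorant_le_hull_fun[OF subdifferential_affine_minorant[OF this]]
    have "F x - d * x + d * y \<le> H y" for y
      by (metis H ereal_less_eq(3))
    then show "d \<in> subdifferential H x"
      by (simp add: subdifferential_def Hx algebra_simps)
  next
    fix d assume d: "d \<in> subdifferential H x"
    have "H y \<le> F y" for y
      by (metis H convex_hull_fun_le ereal_less_eq(3))
    with d show "d \<in> subdifferential F x"
      by (auto simp: subdifferential_def Hx intro: order_trans)
  qed
  also have "\<dots> = {left_deriv H x..right_deriv H x}"
    unfolding H_def by (intro subdifferential_convex convex_on_convex_hull_fun[OF c])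
  finally show ?thesis .
qed

end

subsection \<open>Mean slopes at infinity\<close>

text \<open>Divide the supporting inequality by \<open>y > 0\<close>; the left side then tends to
  \<open>c\<close>.\<close>

lemma subdifferential_le_lower_mean:
  assumes "c \<in> subdifferential F x"
  shows "ereal c \<le> Liminf at_top (\<lambda>y. ereal (F y / y))"
proof -
  have "((\<lambda>y. F x / y + c * (1 - x / y)) \<longlongrightarrow> 0 + c * (1 - 0)) at_top"
    by (intro tendsto_intros tendsto_divide_0[OF tendsto_const] filterlim_at_top_imp_at_infinity filterlim_ident)
  then have "Liminf at_top (\<lambda>y. ereal (F x / y + c * (1 - x / y))) = ereal c"
    by (intro lim_imp_Liminf) auto
  moreover have "Liminf at_top (\<lambda>y. ereal (F x / y + c * (1 - x / y))) \<le> Liminf at_top (\<lambda>y. ereal (F y / y))"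
  proof (rule Liminf_mono)
    show "\<forall>\<^sub>F y in at_top. ereal (F x / y + c * (1 - x / y)) \<le> ereal (F y / y)"
      using eventually_gt_at_top[of 0]
    proof eventually_elim
      case (elim y)
      have "F x / y + c * (1 - x / y) = (F x + c * (y - x)) / y"
        using elim by (simp add: field_simps)
      also have "\<dots> \<le> F y / y"
        using assms elim by (intro divide_right_mono) (auto simp: subdifferential_def)
      finally show ?case by simp
    qed
  qed
  ultimately show ?thesis by simp
qed

text \<open>The mirror image: division by \<open>y < 0\<close> reverses the inequality, so
  \<open>c\<close> bounds the means from above.\<close>

lemma upper_mean_le_subdifferential:
  assumes "c \<in> subdifferential F x"
  shows "Limsup at_bot (\<lambda>y. ereal (F y / y)) \<le> ereal c"
proof -
  have "((\<lambda>y. F x / y + c * (1 - x / y)) \<longlongrightarrow> 0 + c * (1 - 0)) at_bot"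
    by (intro tendsto_intros tendsto_divide_0[OF tendsto_const] filterlim_at_bot_imp_at_infinity filterlim_ident)
  then have "Limsup at_bot (\<lambda>y. ereal (F x / y + c * (1 - x / y))) = ereal c"
    by (intro lim_imp_Limsup) auto
  moreover have "Limsup at_bot (\<lambda>y. ereal (F y / y)) \<le> Limsup at_bot (\<lambda>y. ereal (F x / y + c * (1 - x / y)))"
  proof (rule Limsup_mono)
    show "\<forall>\<^sub>F y in at_bot. ereal (F y / y) \<le> ereal (F x / y + c * (1 - x / y))"
      using eventually_gt_at_bot[of 0]
    proof eventually_elim
      case (elim y)
      have "F y / y \<le> (F x + c * (y - x)) / y"
        using assms elim by (intro divide_right_mono_neg) (auto simp: subdifferential_def)
      also have "\<dots> = F x / y + c * (1 - x / y)"
        using elim by (simp add: field_simps)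
      finally show ?case by simp
    qed
  qed
  ultimately show ?thesis by simp
qed

text \<open>For a slope \<open>m\<close> strictly between the two means, \<open>F y - m * y\<close>
  is coercive, so it has a global minimizer, and there \<open>m\<close> is a subgradient.\<close>

lemma subdifferential_nonempty_of_means:
  fixes F :: "real \<Rightarrow> real"
  assumes F: "continuous_on UNIV F"
    and means: "Limsup at_bot (\<lambda>y. ereal (F y / y)) < Liminf at_top (\<lambda>y. ereal (F y / y))"
  shows "\<exists>x. subdifferential F x \<noteq> {}"
proof -
  obtain q where q: "Limsup at_bot (\<lambda>y. ereal (F y / y)) < ereal q"
      "ereal q < Liminf at_top (\<lambda>y. ereal (F y / y))"
    using ereal_dense2[OF means] by auto
  obtain p where p: "Limsup at_bot (\<lambda>y. ereal (F y / y)) < ereal p" "p < q"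
    using ereal_dense2[OF q(1)] by auto
  obtain m where m: "p < m" "m < q"
    using dense[OF p(2)] by blast
  have "\<forall>\<^sub>F y in at_top. ereal q < ereal (F y / y)"
    using less_LiminfD[OF q(2)] .
  then obtain K where K: "\<And>y. y \<ge> K \<Longrightarrow> q < F y / y"
    by (auto simp: eventually_at_top_linorder)
  have "\<forall>\<^sub>F y in at_bot. ereal (F y / y) < ereal p"
    using Limsup_lessD[OF p(1)] .
  then obtain L where L: "\<And>y. y \<le> L \<Longrightarrow> F y / y < p"
    by (auto simp: eventually_at_bot_linorder)
  \<comment> \<open>Beyond \<open>R\<close> the mean bounds with \<open>q\<close> and
    \<open>p\<close> hold, and the linear gains \<open>(q - m) * y\<close> on the right and
    \<open>(m - p) * (- y)\<close> on the left exceed \<open>\<bar>F 0\<bar>\<close>. Outside the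
    interval \<open>?h\<close> is therefore above \<open>?h 0\<close>, so the minimizer over the
    interval is global.\<close>
  define R where "R = \<bar>K\<bar> + \<bar>L\<bar> + \<bar>F 0\<bar> / (q - m) + \<bar>F 0\<bar> / (m - p) + 1"
  have R: "R > 0" "R > K" "R > - L" "R > \<bar>F 0\<bar> / (q - m)" "R > \<bar>F 0\<bar> / (m - p)"
  proof -
    have "0 \<le> \<bar>F 0\<bar> / (q - m)" "0 \<le> \<bar>F 0\<bar> / (m - p)"
      using m by simp_all
    then show "R > 0" "R > K" "R > - L" "R > \<bar>F 0\<bar> / (q - m)" "R > \<bar>F 0\<bar> / (m - p)"
      unfolding R_def by linarith+
  qed
  let ?h = "\<lambda>y. F y - m * y"
  have "continuous_on {-R..R} ?h"
    by (intro continuous_intros continuous_on_subset[OF F]) auto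
  then obtain x where x: "\<And>y. y \<in> {-R..R} \<Longrightarrow> ?h x \<le> ?h y"
    using continuous_attains_inf[of "{-R..R}" ?h] R(1) by (auto simp del: atLeastAtMost_iff)
  have x0: "?h x \<le> F 0"
    using x[of 0] R(1) by simp
  have "?h x \<le> ?h y" for y
  proof -
    consider "y \<in> {-R..R}" | "y > R" | "y < - R" by force
    then show ?thesis
    proof cases
      case 2
      then have "F y > q * y"
        using K[of y] R by (simp add: pos_less_divide_eq)
      moreover have "\<bar>F 0\<bar> < y * (q - m)"
        using 2 R m by (auto simp: pos_divide_less_eq intro: less_trans)
      ultimately show ?thesis
        using x0 by (simp add: algebra_simps)
    next
      case 3
      then have "F y > p * y"
        using L[of y] R by (simp add: neg_divide_less_eq)
      moreover have "\<bar>F 0\<bar> / (m - p) < - y"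
        using 3 R by linarith
      then have "\<bar>F 0\<bar> < - y * (m - p)"
        using m by (simp add: pos_divide_less_eq)
      ultimately show ?thesis
        using x0 by (simp add: algebra_simps)
    qed (use x in blast)
  qed
  then have "m \<in> subdifferential F x"
    by (simp add: subdifferential_def algebra_simps)
  then show ?thesis by blast
qed

subsection \<open>The variational formula\<close>

lemma L_infinity_set_integrable:
  assumes "\<phi> \<in> L_infinity" "S \<in> lmeasurable"
  shows "set_integrable lebesgue S \<phi>"
proof -
  from assms(1) obtain M where M: "AE x in lebesgue. \<bar>\<phi> x\<bar> \<le> M"
    by (auto simp: L_infinity_def)
  have "\<phi> \<in> borel_measurable lebesgue"
    using assms(1) by (simp add: L_infinity_def)
  then have meas: "(\<lambda>x. indicator S x *\<^sub>R \<phi> x) \<in> borel_measurable lebesgue"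
    using assms(2) by (intro borel_measurable_scaleR borel_measurable_indicator) auto
  have bound: "integrable lebesgue (\<lambda>x. indicat_real S x *\<^sub>R \<bar>M\<bar>)"
    using assms(2)
    by (intro integrable_scaleR_left integrable_real_indicator) (auto simp: fmeasurable_def)
  have "AE x in lebesgue. norm (indicator S x *\<^sub>R \<phi> x) \<le> norm (indicator S x *\<^sub>R \<bar>M\<bar>)"
    using M by eventually_elim (auto simp: indicator_def)
  from Bochner_Integration.integrable_bound[OF bound meas this] show ?thesis
    unfolding set_integrable_def .
qed

text \<open>Turns the oriented integrals from 0 into ordinary ones over \<open>{y..z}\<close>; the
  cases are the positions of 0 relative to \<open>y\<close> and \<open>z\<close>.\<close>

lemma primitive_diff:
  assumes \<phi>: "\<phi> \<in> L_infinity" and "y \<le> z"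
  shows "primitive \<phi> z - primitive \<phi> y = integral {y..z} \<phi>"
proof -
  have int: "\<phi> integrable_on {a..b}" for a b
    using L_infinity_set_integrable[OF \<phi>, of "{a..b}"]
    by (intro set_lebesgue_integral_eq_integral(1)) auto
  have open_int: "(LINT \<xi>:{a<..<b}|lebesgue. \<phi> \<xi>) = integral {a..b} \<phi>" for a b
    using set_lebesgue_integral_eq_integral(2)[OF L_infinity_set_integrable[OF \<phi>, of "{a<..<b}"]]
    by (simp add: integral_open_interval_real)
  have prim: "primitive \<phi> x = (if 0 \<le> x then integral {0..x} \<phi> else - integral {x..0} \<phi>)" for x
    by (simp add: primitive_def interval_lebesgue_integral_def open_int)
  consider "0 \<le> y" | "y < 0" "0 \<le> z" | "z < 0" by linarith
  then show ?thesis
  proof cases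
    case 1
    then show ?thesis
      using Henstock_Kurzweil_Integration.integral_combine[of 0 y z \<phi>] int assms(2) by (simp add: prim)
  next
    case 2
    then show ?thesis
      using Henstock_Kurzweil_Integration.integral_combine[of y 0 z \<phi>] int by (simp add: prim)
  next
    case 3
    then show ?thesis
      using Henstock_Kurzweil_Integration.integral_combine[of y z 0 \<phi>] int assms(2) by (simp add: prim)
  qed
qed

lemma continuous_on_primitive:
  assumes "\<phi> \<in> L_infinity"
  shows "continuous_on UNIV (primitive \<phi>)"
proof -
  have "isCont (primitive \<phi>) x" for x
  proof -
    have "\<phi> integrable_on {x - 1..x + 1}"
      using L_infinity_set_integrable[OF assms, of "{x - 1..x + 1}"]
      by (intro set_lebesgue_integral_eq_integral(1)) auto
    then have "continuous_on {x - 1..x + 1} (\<lambda>y. primitive \<phi> (x - 1) + integral {x - 1..y} \<phi>)"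
      by (intro continuous_intros indefinite_integral_continuous_1)
    then have "continuous_on {x - 1..x + 1} (primitive \<phi>)"
    proof (rule continuous_on_eq)
      fix y assume "y \<in> {x - 1..x + 1}"
      then show "primitive \<phi> (x - 1) + integral {x - 1..y} \<phi> = primitive \<phi> y"
        using primitive_diff[OF assms, of "x - 1" y] by simp
    qed
    then show ?thesis
      by (rule continuous_on_interior) simp
  qed
  then show ?thesis
    by (simp add: continuous_at_imp_continuous_on)
qed

section \<open>The flux and the substitution in the functional \<open>E_fun\<close>\<close>

context
  fixes f :: "real \<Rightarrow> real"
  assumes C2: "C2 f"
    and nonneg: "\<And>s. deriv (deriv f) s \<ge> 0"
    and null: "{s. deriv (deriv f) s = 0} \<in> null_sets lebesgue"
begin

lemma flux_deriv: "(f has_real_derivative deriv f s) (at s within S)"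
  using C2 unfolding C2_def differentiable_on_def
  by (meson DERIV_deriv_iff_real_differentiable UNIV_I has_field_derivative_at_within)

lemma flux_deriv2: "(deriv f has_real_derivative deriv (deriv f) s) (at s within S)"
  using C2 unfolding C2_def differentiable_on_def
  by (meson DERIV_deriv_iff_real_differentiable UNIV_I has_field_derivative_at_within)

lemma continuous_on_flux_deriv: "continuous_on S (deriv f)"
  using flux_deriv2 by (metis DERIV_continuous_on)

text \<open>Equal values at \<open>p < q\<close> would make \<open>deriv f\<close> constant between
  them, so its derivative would vanish on an interval of positive measure.\<close>

lemma strict_mono_flux_deriv: "strict_mono (deriv f)"
proof (rule strict_monoI)
  fix p q :: real assume "p < q"
  have mono: "deriv f y \<le> deriv f z" if "y \<le> z" for y z
    by (rule DERIV_nonneg_imp_nondecreasing[OF that]) (use nonneg flux_deriv2 in blast)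
  show "deriv f p < deriv f q"
  proof (rule ccontr)
    assume "\<not> deriv f p < deriv f q"
    then have const: "deriv f s = deriv f p" if "s \<in> {p<..<q}" for s
      using mono[of p s] mono[of s q] that by auto
    have "deriv (deriv f) s = 0" if "s \<in> {p<..<q}" for s
    proof -
      have "((\<lambda>_. deriv f p) has_real_derivative deriv (deriv f) s) (at s)"
        using flux_deriv2 open_greaterThanLessThan that const
        by (rule has_field_derivative_transform_within_open)
      then show ?thesis using DERIV_const DERIV_unique by blast
    qed
    then have "{p<..<q} \<in> null_sets lebesgue"
      by (intro null_sets_subset[OF null]) auto
    then show False
      using \<open>p < q\<close> by (simp add: null_sets_def)
  qed
qed

lemma flux_above_tangent:
  assumes "u \<noteq> c"
  shows "f c + deriv f c * (u - c) < f u"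
proof (cases "u < c")
  case True
  then obtain z where "u < z" "z < c" "f c - f u = (c - u) * deriv f z"
    using MVT2[OF True] flux_deriv by blast
  then show ?thesis
    using strict_monoD[OF strict_mono_flux_deriv, of z c] mult_strict_left_mono[of "deriv f z" "deriv f c" "c - u"]
    by (simp add: algebra_simps)
next
  case False
  with assms have "c < u" by simp
  then obtain z where "c < z" "z < u" "f u - f c = (u - c) * deriv f z"
    using MVT2[OF \<open>c < u\<close>] flux_deriv by blast
  then show ?thesis
    using strict_monoD[OF strict_mono_flux_deriv, of c z] mult_strict_left_mono[of "deriv f c" "deriv f z" "u - c"]
    by (simp add: algebra_simps)
qed

text \<open>The \<open>\<phi>\<close> part is the substitution
  \<open>\<xi> = x - t * deriv f s\<close>, injective and decreasing with Jacobian
  \<open>t * deriv (deriv f) s\<close> in absolute value. The remaining part has the antiderivative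
  \<open>s * deriv f s - f s\<close>, the Legendre transform of \<open>f\<close> at
  \<open>deriv f s\<close>.\<close>

lemma E_integrand_integral:
  assumes \<phi>: "\<phi> \<in> L_infinity" and t: "t > 0" and "p \<le> q"
  shows "t * (LINT s:{p<..<q}|lebesgue. deriv (deriv f) s * (\<phi> (x - t * deriv f s) - s)) =
    primitive \<phi> (x - t * deriv f p) - primitive \<phi> (x - t * deriv f q)
      - t * ((q * deriv f q - f q) - (p * deriv f p - f p))"
proof -
  let ?g = "\<lambda>s. x - t * deriv f s"
  have img: "?g ` {p..q} = {?g q..?g p}"
  proof
    show "?g ` {p..q} \<subseteq> {?g q..?g p}"
      using t strict_mono_less_eq[OF strict_mono_flux_deriv] by auto
    show "{?g q..?g p} \<subseteq> ?g ` {p..q}"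
    proof
      fix y assume "y \<in> {?g q..?g p}"
      moreover have "continuous_on {p..q} ?g"
        by (intro continuous_intros continuous_on_flux_deriv)
      ultimately show "y \<in> ?g ` {p..q}"
        using IVT2'[of ?g q y p] \<open>p \<le> q\<close> by auto
    qed
  qed
  have "(?g has_field_derivative - t * deriv (deriv f) s) (at s within {p..q})" for s
    by (auto intro!: derivative_eq_intros flux_deriv2)
  moreover have "inj_on ?g {p..q}"
    using t strict_mono_eq[OF strict_mono_flux_deriv] by (auto simp: inj_on_def)
  ultimately have subst: "(\<lambda>s. \<bar>- t * deriv (deriv f) s\<bar> * \<phi> (?g s)) absolutely_integrable_on {p..q} \<and>
      integral {p..q} (\<lambda>s. \<bar>- t * deriv (deriv f) s\<bar> * \<phi> (?g s)) = integral {?g q..?g p} \<phi>"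
    using L_infinity_set_integrable[OF \<phi>, of "{?g q..?g p}"] img
    by (subst has_absolute_integral_change_of_variables_1') auto
  have abs: "\<bar>- t * deriv (deriv f) s\<bar> = t * deriv (deriv f) s" for s
    using t nonneg[of s] by (simp add: abs_mult)
  have "?g q \<le> ?g p"
    using t strict_mono_less_eq[OF strict_mono_flux_deriv] \<open>p \<le> q\<close> by simp
  note prim = primitive_diff[OF \<phi> this]
  have cont: "continuous_on {p..q} (\<lambda>s. t * (s * deriv (deriv f) s))"
    using C2 by (intro continuous_intros) (auto simp: C2_def elim: continuous_on_subset)
  have ftc: "((\<lambda>s. t * (s * deriv (deriv f) s)) has_integral
      t * (q * deriv f q - f q) - t * (p * deriv f p - f p)) {p..q}"
    using \<open>p \<le> q\<close>
    by (intro fundamental_theorem_of_calculus)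
      (auto intro!: derivative_eq_intros flux_deriv flux_deriv2
        simp: has_real_derivative_iff_has_vector_derivative[symmetric] algebra_simps)
  let ?k = "\<lambda>s. t * deriv (deriv f) s * \<phi> (?g s) - t * (s * deriv (deriv f) s)"
  have int: "?k absolutely_integrable_on {p..q}"
    using subst cont unfolding abs
    by (intro set_integral_diff(1) absolutely_integrable_continuous_real[OF cont]) auto
  have "t * (LINT s:{p<..<q}|lebesgue. deriv (deriv f) s * (\<phi> (?g s) - s)) = (LINT s:{p<..<q}|lebesgue. ?k s)"
    by (simp add: set_integral_mult_right[symmetric] algebra_simps)
  \<comment> \<open>Oriented Lebesgue integrals run over open intervals, while the substitution was
    made on the closed one.\<close>
  also have "\<dots> = integral {p<..<q} ?k"
    by (intro set_lebesgue_integral_eq_integral(2) set_integrable_subset[OF int]) auto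
  also have "\<dots> = integral {p..q} ?k"
    by (simp add: integral_open_interval_real)
  also have "\<dots> = integral {?g q..?g p} \<phi> - (t * (q * deriv f q - f q) - t * (p * deriv f p - f p))"
    using subst has_integral_integrable[OF ftc] unfolding abs integral_unique[OF ftc, symmetric]
    by (subst integral_diff) (auto simp del: integral_mult_right simp: set_lebesgue_integral_eq_integral(1))
  finally show ?thesis
    using prim by (simp add: algebra_simps)
qed

lemma E_fun_eq:
  assumes "\<phi> \<in> L_infinity" "t > 0"
  shows "E_fun f \<phi> x t u =
    primitive \<phi> (x - t * deriv f 0) - primitive \<phi> (x - t * deriv f u) - t * (u * deriv f u - f u + f 0)"
proof (cases "0 \<le> u")
  case True
  then show ?thesis
    using E_integrand_integral[OF assms, of 0 u x]
    by (simp add: E_fun_def interval_lebesgue_integral_def)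
next
  case False
  then show ?thesis
    using E_integrand_integral[OF assms, of u 0 x]
    by (simp add: E_fun_def interval_lebesgue_integral_def algebra_simps)
qed

section \<open>Divides as supporting lines of the primitive\<close>

lemma divide_states_eq_subdifferential:
  assumes \<phi>: "\<phi> \<in> L_infinity"
  shows "divide_states f \<phi> x = subdifferential (primitive \<phi>) x"
proof (intro subset_antisym subsetI)
  let ?P = "primitive \<phi>" and ?a = "deriv f"
  fix c assume "c \<in> divide_states f \<phi> x"
  then have max: "maximizers f \<phi> (x + t * ?a c) t = {c}" if "t > 0" for t
    using that by (auto simp: divide_states_def char_line_def)
  \<comment> \<open>The time \<open>t\<close> is chosen so that the competitor \<open>u\<close> on
    the line of \<open>c\<close> sees the primitive exactly at \<open>y\<close>. The sign condition
    on \<open>u\<close> and \<open>y\<close> makes \<open>t\<close> positive.\<close>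
  have bound: "?P x + u * (y - x) \<le> ?P y" if "(u < c \<and> x < y) \<or> (c < u \<and> y < x)" for u y
  proof -
    define t where "t = (y - x) / (?a c - ?a u)"
    have ne: "?a c - ?a u \<noteq> 0"
      using that strict_mono_eq[OF strict_mono_flux_deriv, of c u] by auto
    have "t > 0"
      using that strict_mono_less[OF strict_mono_flux_deriv] by (auto simp: t_def zero_less_divide_iff)
    have ty: "t * (?a c - ?a u) = y - x"
      using ne by (simp add: t_def)
    have "E_fun f \<phi> (x + t * ?a c) t u \<le> E_fun f \<phi> (x + t * ?a c) t c"
      using max[OF \<open>t > 0\<close>] by (auto simp: maximizers_def)
    moreover have "x + t * ?a c - t * ?a u = y"
      using ty by (simp add: algebra_simps)
    ultimately have "?P x + t * (c * ?a c - f c) \<le> ?P y + t * (u * ?a u - f u)"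
      by (simp add: E_fun_eq[OF \<phi> \<open>t > 0\<close>] algebra_simps)
    \<comment> \<open>The tangent to \<open>f\<close> at \<open>c\<close> lies below
      \<open>f u\<close>; equivalently, \<open>u\<close> is a subgradient of the Legendre transform
      at \<open>?a u\<close>. This gives a supporting inequality with slope \<open>u\<close>, not
      yet \<open>c\<close>.\<close>
    moreover have "t * (u * (?a c - ?a u)) \<le> t * ((c * ?a c - f c) - (u * ?a u - f u))"
      using flux_above_tangent[of u c] that \<open>t > 0\<close>
      by (intro mult_left_mono) (auto simp: algebra_simps)
    moreover have "t * (u * (?a c - ?a u)) = u * (y - x)"
      using ty by (simp add: mult.left_commute)
    ultimately show ?thesis by (simp add: algebra_simps)
  qed
  have "?P x + c * (y - x) \<le> ?P y" for y
  proof (cases x y rule: linorder_cases)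
    case less
    \<comment> \<open>For \<open>y\<close> to the right of \<open>x\<close>, the competitors
      \<open>u\<close> must approach \<open>c\<close> from below; the other case is
      symmetric.\<close>
    have "((\<lambda>u. ?P x + u * (y - x)) \<longlongrightarrow> ?P x + c * (y - x)) (at_left c)"
      by (intro tendsto_intros)
    moreover have "\<forall>\<^sub>F u in at_left c. ?P x + u * (y - x) \<le> ?P y"
      using bound less by (auto simp: eventually_at_filter)
    ultimately show ?thesis
      by (rule tendsto_upperbound) simp
  next
    case greater
    have "((\<lambda>u. ?P x + u * (y - x)) \<longlongrightarrow> ?P x + c * (y - x)) (at_right c)"
      by (intro tendsto_intros)
    moreover have "\<forall>\<^sub>F u in at_right c. ?P x + u * (y - x) \<le> ?P y"
      using bound greater by (auto simp: eventually_at_filter)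
    ultimately show ?thesis
      by (rule tendsto_upperbound) simp
  qed simp
  then show "c \<in> subdifferential ?P x"
    by (simp add: subdifferential_def)
next
  let ?P = "primitive \<phi>" and ?a = "deriv f"
  fix c assume "c \<in> subdifferential ?P x"
  then have c: "?P x + c * (y - x) \<le> ?P y" for y
    by (simp add: subdifferential_def)
  have "maximizers f \<phi> (x + t * ?a c) t = {c}" if "t > 0" for t
  proof -
    have less: "E_fun f \<phi> (x + t * ?a c) t u < E_fun f \<phi> (x + t * ?a c) t c" if "u \<noteq> c" for u
    proof -
      \<comment> \<open>Here the tangent at \<open>u\<close> is compared with \<open>f c\<close>;
        strictness makes \<open>c\<close> the only maximizer.\<close>
      have "t * (c * ?a c - f c - (u * ?a u - f u)) < t * (c * (?a c - ?a u))"
        using flux_above_tangent[of c u] that \<open>t > 0\<close>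
        by (intro mult_strict_left_mono) (auto simp: algebra_simps)
      moreover have "?P x + c * (t * (?a c - ?a u)) \<le> ?P (x + t * ?a c - t * ?a u)"
        using c[of "x + t * ?a c - t * ?a u"] by (simp add: algebra_simps)
      ultimately show ?thesis
        by (simp add: E_fun_eq[OF \<phi> \<open>t > 0\<close>] algebra_simps)
    qed
    have "E_fun f \<phi> (x + t * ?a c) t u \<le> E_fun f \<phi> (x + t * ?a c) t c" for u
      using less[of u] by (cases "u = c") auto
    moreover have "u = c" if "\<forall>v. E_fun f \<phi> (x + t * ?a c) t v \<le> E_fun f \<phi> (x + t * ?a c) t u" for u
      using less[of u] that by (meson leD)
    ultimately show ?thesis
      unfolding maximizers_def by blast
  qed
  then show "c \<in> divide_states f \<phi> x"
    by (auto simp: divide_states_def char_line_def)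
qed

text \<open>By the intermediate value theorem every point of the fan lies on the line of some state
  \<open>c\<close> between \<open>l\<close> and \<open>r\<close>. Since
  \<open>(x - x\<^sub>0) / t\<close> is then a value of the injective \<open>deriv f\<close>,
  \<open>inv\<close> returns \<open>c\<close> there.\<close>

lemma rarefaction_fan:
  assumes sub: "{l..r} \<subseteq> divide_states f \<phi> x\<^sub>0" "l < r" and t: "t > 0"
    and x: "x \<in> {x\<^sub>0 + t * deriv f l<..<x\<^sub>0 + t * deriv f r}"
  shows "(x, t) \<in> \<Union> (divides_from f \<phi> x\<^sub>0)"
    and "entropy_solution f \<phi> x t = inv (deriv f) ((x - x\<^sub>0) / t)"
proof -
  have "deriv f l \<le> (x - x\<^sub>0) / t" "(x - x\<^sub>0) / t \<le> deriv f r"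
    using x t by (auto simp: field_simps)
  then obtain c where "l \<le> c" "c \<le> r" and ac: "deriv f c = (x - x\<^sub>0) / t"
    using IVT'[of "deriv f" l "(x - x\<^sub>0) / t" r] sub(2) continuous_on_flux_deriv by auto
  then have c: "c \<in> divide_states f \<phi> x\<^sub>0"
    using sub(1) by auto
  have line: "(x, t) \<in> char_line f x\<^sub>0 c"
    using t ac by (simp add: char_line_def)
  then show "(x, t) \<in> \<Union> (divides_from f \<phi> x\<^sub>0)"
    using c unfolding divides_from_def by blast
  have "maximizers f \<phi> x t = {c}"
    using c line unfolding divide_states_def by blast
  then show "entropy_solution f \<phi> x t = inv (deriv f) ((x - x\<^sub>0) / t)"
    by (simp add: entropy_solution_def ac[symmetric] strict_mono_imp_inj_on[OF strict_mono_flux_deriv])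
qed

end

theorem theorem6p10:
  fixes f \<phi> :: "real \<Rightarrow> real"
  assumes "C2 f"
    and "\<And>s. deriv (deriv f) s \<ge> 0"
    and "{s. deriv (deriv f) s = 0} \<in> null_sets lebesgue"
    and "\<phi> \<in> L_infinity"
  shows
    "(upper_mean_left \<phi> < lower_mean_right \<phi> \<longrightarrow>
        has_divides f \<phi> \<and>
        (\<forall>x\<^sub>0. (divide_states f \<phi> x\<^sub>0 \<noteq> {} \<longleftrightarrow>
                  ereal (primitive \<phi> x\<^sub>0) = convex_hull_fun (primitive \<phi>) x\<^sub>0) \<and>
              (ereal (primitive \<phi> x\<^sub>0) = convex_hull_fun (primitive \<phi>) x\<^sub>0 \<longrightarrow>
                 divide_states f \<phi> x\<^sub>0 = {hull_left_deriv \<phi> x\<^sub>0..hull_right_deriv \<phi> x\<^sub>0} \<and>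
                 (hull_left_deriv \<phi> x\<^sub>0 = hull_right_deriv \<phi> x\<^sub>0 \<longrightarrow>
                    divides_from f \<phi> x\<^sub>0 =
                      {{(x, t). x = x\<^sub>0 + t * deriv f (hull_left_deriv \<phi> x\<^sub>0) \<and> t > 0}}) \<and>
                 (hull_left_deriv \<phi> x\<^sub>0 < hull_right_deriv \<phi> x\<^sub>0 \<longrightarrow>
                    (\<forall>t>0. \<forall>x \<in> {x\<^sub>0 + t * deriv f (hull_left_deriv \<phi> x\<^sub>0)
                                  <..< x\<^sub>0 + t * deriv f (hull_right_deriv \<phi> x\<^sub>0)}.
                       (x, t) \<in> \<Union> (divides_from f \<phi> x\<^sub>0) \<and>
                       entropy_solution f \<phi> x t = inv (deriv f) ((x - x\<^sub>0) / t)))))) \<and>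
     (upper_mean_left \<phi> = lower_mean_right \<phi> \<longrightarrow>
        (has_divides f \<phi> \<longleftrightarrow>
           (\<exists>x\<^sub>0. ereal (primitive \<phi> x\<^sub>0) = convex_hull_fun (primitive \<phi>) x\<^sub>0)) \<and>
        (\<forall>x\<^sub>0. ereal (primitive \<phi> x\<^sub>0) = convex_hull_fun (primitive \<phi>) x\<^sub>0 \<longrightarrow>
           divides_from f \<phi> x\<^sub>0 =
             {{(x, t). x = x\<^sub>0 + t * deriv f (real_of_ereal (lower_mean_right \<phi>)) \<and> t > 0}})) \<and>
     (upper_mean_left \<phi> > lower_mean_right \<phi> \<longrightarrow> \<not> has_divides f \<phi>)"
proof -
  let ?P = "primitive \<phi>" and ?D = "divide_states f \<phi>"
  note flux = assms(1-3) and \<phi> = assms(4)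
  note cont = continuous_on_primitive[OF \<phi>]
  have D: "?D x = subdifferential ?P x" for x
    using divide_states_eq_subdifferential[OF flux \<phi>] .
  have nonempty_iff: "?D x \<noteq> {} \<longleftrightarrow> ereal (?P x) = convex_hull_fun ?P x" for x
    unfolding D
    using hull_eq_of_subdifferential[OF cont] subdifferential_nonempty_of_hull_eq[OF cont] by blast
  have D_Icc: "?D x = {hull_left_deriv \<phi> x..hull_right_deriv \<phi> x}"
    if "ereal (?P x) = convex_hull_fun ?P x" for x
    unfolding D hull_left_deriv_def hull_right_deriv_def
    by (rule subdifferential_eq_hull_derivs[OF cont that])
  have lower: "ereal c \<le> lower_mean_right \<phi>" and upper: "upper_mean_left \<phi> \<le> ereal c"
    if "c \<in> ?D x" for c x
    using that unfolding D lower_mean_right_def upper_mean_left_def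
    by (rule subdifferential_le_lower_mean upper_mean_le_subdifferential)+
  have single: "divides_from f \<phi> x = {{(y, t). y = x + t * deriv f c \<and> t > 0}}"
    if "?D x = {c}" for x c
    by (simp add: divides_from_def that char_line_def)
  have strict: "has_divides f \<phi>" if "upper_mean_left \<phi> < lower_mean_right \<phi>"
    using subdifferential_nonempty_of_means[OF cont] that
    unfolding has_divides_def D upper_mean_left_def lower_mean_right_def by blast
  have unique: "divides_from f \<phi> x = {{(y, t). y = x + t * deriv f (hull_left_deriv \<phi> x) \<and> t > 0}}"
    if "ereal (?P x) = convex_hull_fun ?P x" "hull_left_deriv \<phi> x = hull_right_deriv \<phi> x" for x
    using D_Icc[OF that(1)] that(2) by (intro single) simp
  have fan: "(y, t) \<in> \<Union> (divides_from f \<phi> x) \<and>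
      entropy_solution f \<phi> y t = inv (deriv f) ((y - x) / t)"
    if "ereal (?P x) = convex_hull_fun ?P x" "hull_left_deriv \<phi> x < hull_right_deriv \<phi> x" "t > 0"
      "y \<in> {x + t * deriv f (hull_left_deriv \<phi> x)<..<x + t * deriv f (hull_right_deriv \<phi> x)}"
    for x y t
    using rarefaction_fan[OF flux _ that(2-4)] D_Icc[OF that(1)] by blast
  have equal_means: "divides_from f \<phi> x =
      {{(y, t). y = x + t * deriv f (real_of_ereal (lower_mean_right \<phi>)) \<and> t > 0}}"
    if eq: "upper_mean_left \<phi> = lower_mean_right \<phi>" and "ereal (?P x) = convex_hull_fun ?P x" for x
  proof (rule single)
    \<comment> \<open>Every state is squeezed between the two equal means, so the common mean is
      finite and \<open>real_of_ereal\<close> recovers it.\<close>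
    have "lower_mean_right \<phi> = ereal c" if "c \<in> ?D x" for c
      using lower[OF that] upper[OF that] eq by simp
    then have "c = real_of_ereal (lower_mean_right \<phi>)" if "c \<in> ?D x" for c
      using that by fastforce
    moreover have "?D x \<noteq> {}"
      using nonempty_iff that(2) by blast
    ultimately show "?D x = {real_of_ereal (lower_mean_right \<phi>)}"
      by blast
  qed
  \<comment> \<open>Any state would lie above the left mean and below the right one, forcing the
    opposite order.\<close>
  have none: "\<not> has_divides f \<phi>" if "upper_mean_left \<phi> > lower_mean_right \<phi>"
    using lower upper that unfolding has_divides_def
    by (metis all_not_in_conv leD order_trans)
  have ex: "has_divides f \<phi> \<longleftrightarrow> (\<exists>x. ereal (?P x) = convex_hull_fun ?P x)"
    unfolding has_divides_def nonempty_iff ..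
  show ?thesis
    by (intro conjI impI allI ballI)
      (rule strict nonempty_iff D_Icc unique fan[THEN conjunct1] fan[THEN conjunct2]
        ex equal_means none; assumption)+
qed

end
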